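(* Let $R$ be a semiprime local ring with $\mathrm{Soc}(R_R)\neq 0$. Then every right $R$-module is monoartinian if and only if $R$ is a homogeneous semisimple ring.
   Context: Rings are associative with identity and modules are unitary right modules. A module $A$ is embedded in a module $B$ if there is an injective homomorphism $A\to B$. A module $M$ is monoartinian if for every descending chain $M_1\supseteq M_2\supseteq\cdots$ of submodules of $M$ there exists $n\ge1$ such that $M_n$ is embedded in $M_i$ for every $i\ge n$. $\mathrm{Soc}(R_R)$ is the socle of the right module $R_R$. A ring $R$ is homogeneous semisimple if the module $R_R$ is a direct sum of pairwise isomorphic simple modules. *)

theory Defs
  imports "HOL-Algebra.Ideal_Product" "HOL-Algebra.Generated_Groups"
begin

section \<open>Right modules\<close>

text \<open>The library's modules are left modules over commutative rings. The record below follows its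
  convention of extending \<open>ring\<close>; the fields \<open>mult\<close> and \<open>one\<close> of a module play no role.\<close>

record ('a, 'b) rmodule = "'b ring" +
  rsmult :: "['b, 'a] \<Rightarrow> 'b"  (infixl \<open>\<lhd>\<index>\<close> 70)

locale right_module = R?: ring R + M?: abelian_group M
  for R :: "('a, 'c) ring_scheme" (structure) and M :: "('a, 'b, 'd) rmodule_scheme" (structure) +
  assumes rsmult_closed [simp, intro]:
      "\<lbrakk>x \<in> carrier M; a \<in> carrier R\<rbrakk> \<Longrightarrow> x \<lhd>\<^bsub>M\<^esub> a \<in> carrier M"
    and rsmult_add_ring:
      "\<lbrakk>x \<in> carrier M; a \<in> carrier R; b \<in> carrier R\<rbrakk> \<Longrightarrow>
        x \<lhd>\<^bsub>M\<^esub> (a \<oplus>\<^bsub>R\<^esub> b) = (x \<lhd>\<^bsub>M\<^esub> a) \<oplus>\<^bsub>M\<^esub> (x \<lhd>\<^bsub>M\<^esub> b)"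
    and rsmult_add_module:
      "\<lbrakk>x \<in> carrier M; y \<in> carrier M; a \<in> carrier R\<rbrakk> \<Longrightarrow>
        (x \<oplus>\<^bsub>M\<^esub> y) \<lhd>\<^bsub>M\<^esub> a = (x \<lhd>\<^bsub>M\<^esub> a) \<oplus>\<^bsub>M\<^esub> (y \<lhd>\<^bsub>M\<^esub> a)"
    and rsmult_assoc:
      "\<lbrakk>x \<in> carrier M; a \<in> carrier R; b \<in> carrier R\<rbrakk> \<Longrightarrow>
        x \<lhd>\<^bsub>M\<^esub> (a \<otimes>\<^bsub>R\<^esub> b) = (x \<lhd>\<^bsub>M\<^esub> a) \<lhd>\<^bsub>M\<^esub> b"
    and rsmult_one [simp]:
      "x \<in> carrier M \<Longrightarrow> x \<lhd>\<^bsub>M\<^esub> \<one>\<^bsub>R\<^esub> = x"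

locale right_submodule = subgroup H "add_monoid M"
  for H and R :: "('a, 'c) ring_scheme" and M :: "('a, 'b, 'd) rmodule_scheme" (structure) +
  assumes rsmult_closed [simp, intro]:
      "\<lbrakk>x \<in> H; a \<in> carrier R\<rbrakk> \<Longrightarrow> x \<lhd>\<^bsub>M\<^esub> a \<in> H"

text \<open>A submodule \<open>H\<close> of \<open>M\<close>, regarded as a module, is \<open>M\<lparr>carrier := H\<rparr>\<close>.\<close>

definition rmodule_hom ::
  "('a, 'e) ring_scheme \<Rightarrow> ('a, 'b, 'c) rmodule_scheme \<Rightarrow> ('a, 'd, 'f) rmodule_scheme \<Rightarrow> ('b \<Rightarrow> 'd) set"
  where "rmodule_hom R M N =
    {f. f \<in> carrier M \<rightarrow> carrier N
      \<and> (\<forall>x \<in> carrier M. \<forall>y \<in> carrier M. f (x \<oplus>\<^bsub>M\<^esub> y) = f x \<oplus>\<^bsub>N\<^esub> f y)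
      \<and> (\<forall>x \<in> carrier M. \<forall>a \<in> carrier R. f (x \<lhd>\<^bsub>M\<^esub> a) = f x \<lhd>\<^bsub>N\<^esub> a)}"

definition embedded ::
  "('a, 'e) ring_scheme \<Rightarrow> ('a, 'b, 'c) rmodule_scheme \<Rightarrow> ('a, 'd, 'f) rmodule_scheme \<Rightarrow> bool"
  where "embedded R M N \<longleftrightarrow> (\<exists>f \<in> rmodule_hom R M N. inj_on f (carrier M))"

definition rmodule_isomorphic ::
  "('a, 'e) ring_scheme \<Rightarrow> ('a, 'b, 'c) rmodule_scheme \<Rightarrow> ('a, 'd, 'f) rmodule_scheme \<Rightarrow> bool"
  where "rmodule_isomorphic R M N \<longleftrightarrow>
    (\<exists>f \<in> rmodule_hom R M N. bij_betw f (carrier M) (carrier N))"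

definition monoartinian :: "('a, 'e) ring_scheme \<Rightarrow> ('a, 'b, 'c) rmodule_scheme \<Rightarrow> bool"
  where "monoartinian R M \<longleftrightarrow>
    (\<forall>C :: nat \<Rightarrow> 'b set.
      (\<forall>i. right_submodule (C i) R M) \<and> (\<forall>i. C (Suc i) \<subseteq> C i) \<longrightarrow>
      (\<exists>n. \<forall>i \<ge> n. embedded R (M\<lparr>carrier := C n\<rparr>) (M\<lparr>carrier := C i\<rparr>)))"

definition simple_rmodule :: "('a, 'e) ring_scheme \<Rightarrow> ('a, 'b, 'c) rmodule_scheme \<Rightarrow> bool"
  where "simple_rmodule R M \<longleftrightarrow>
    right_module R M \<and> carrier M \<noteq> {\<zero>\<^bsub>M\<^esub>}
      \<and> (\<forall>H. right_submodule H R M \<longrightarrow> H = {\<zero>\<^bsub>M\<^esub>} \<or> H = carrier M)"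

definition simple_submodules :: "('a, 'e) ring_scheme \<Rightarrow> ('a, 'b, 'c) rmodule_scheme \<Rightarrow> 'b set set"
  where "simple_submodules R M =
    {S. right_submodule S R M \<and> simple_rmodule R (M\<lparr>carrier := S\<rparr>)}"

text \<open>The sum of a (possibly infinite or empty) family of submodules, that is, the set of all finite
  sums of elements of its members, is the additive subgroup generated by their union.\<close>

definition submodule_sum :: "('a, 'b, 'c) rmodule_scheme \<Rightarrow> 'b set set \<Rightarrow> 'b set"
  where "submodule_sum M F = generate (add_monoid M) (\<Union>F)"

definition socle :: "('a, 'e) ring_scheme \<Rightarrow> ('a, 'b, 'c) rmodule_scheme \<Rightarrow> 'b set"
  where "socle R M = submodule_sum M (simple_submodules R M)"

text \<open>Internal direct sum. Indexing the summands by themselves loses nothing for nonzero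
  summands, since these are pairwise distinct in a direct sum.\<close>

definition is_direct_sum :: "('a, 'b, 'c) rmodule_scheme \<Rightarrow> 'b set set \<Rightarrow> bool"
  where "is_direct_sum M F \<longleftrightarrow>
    submodule_sum M F = carrier M \<and> (\<forall>S \<in> F. S \<inter> submodule_sum M (F - {S}) = {\<zero>\<^bsub>M\<^esub>})"


section \<open>Rings\<close>

definition regular_rmodule :: "('a, 'e) ring_scheme \<Rightarrow> ('a, 'a) rmodule"
  where "regular_rmodule R =
    \<lparr>carrier = carrier R, mult = mult R, one = one R, zero = zero R, add = add R, rsmult = mult R\<rparr>"

lemma (in ring) right_module_regular: "right_module R (regular_rmodule R)"
proof -
  have "abelian_group (regular_rmodule R)"
    by (rule abelian_groupI)
       (auto simp: regular_rmodule_def a_ac intro: l_neg a_inv_closed bexI[of _ "\<ominus> _"])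
  then show ?thesis
    by (intro right_module.intro right_module_axioms.intro ring_axioms)
       (auto simp: regular_rmodule_def l_distr r_distr m_assoc)
qed

definition homogeneous_semisimple :: "('a, 'e) ring_scheme \<Rightarrow> bool"
  where "homogeneous_semisimple R \<longleftrightarrow> ring R \<and>
    (\<exists>F \<subseteq> simple_submodules R (regular_rmodule R).
      is_direct_sum (regular_rmodule R) F
      \<and> (\<forall>S \<in> F. \<forall>T \<in> F. rmodule_isomorphic R
            ((regular_rmodule R)\<lparr>carrier := S\<rparr>) ((regular_rmodule R)\<lparr>carrier := T\<rparr>)))"

primrec ideal_power :: "('a, 'e) ring_scheme \<Rightarrow> 'a set \<Rightarrow> nat \<Rightarrow> 'a set"
  where
    "ideal_power R I 0 = carrier R"
  | "ideal_power R I (Suc n) = ideal_prod R (ideal_power R I n) I"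

text \<open>Semiprime: no nonzero nilpotent two-sided ideals.\<close>

definition semiprime_ring :: "('a, 'e) ring_scheme \<Rightarrow> bool"
  where "semiprime_ring R \<longleftrightarrow> ring R \<and>
    (\<forall>I. ideal I R \<and> (\<exists>n. ideal_power R I n = {\<zero>\<^bsub>R\<^esub>}) \<longrightarrow> I = {\<zero>\<^bsub>R\<^esub>})"

definition maximal_right_ideal :: "'a set \<Rightarrow> ('a, 'e) ring_scheme \<Rightarrow> bool"
  where "maximal_right_ideal I R \<longleftrightarrow>
    right_submodule I R (regular_rmodule R) \<and> I \<noteq> carrier R
      \<and> (\<forall>J. right_submodule J R (regular_rmodule R) \<and> I \<subseteq> J \<longrightarrow> J = I \<or> J = carrier R)"

text \<open>For not necessarily commutative rings; the zero ring is not local.\<close>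

definition local_ring :: "('a, 'e) ring_scheme \<Rightarrow> bool"
  where "local_ring R \<longleftrightarrow> ring R \<and> (\<exists>!I. maximal_right_ideal I R)"

end

theory Submission
  imports Defs
begin

text \<open>A minimal right ideal \<open>S\<close> of a semiprime ring contains a nonzero idempotent \<open>e\<close> (Brauer). In a
  local ring no two proper right ideals are comaximal, so \<open>eR\<close> and \<open>(1 - e)R\<close> force \<open>S = R\<close>: the ring
  is a division ring, hence homogeneous semisimple. Consequently only one implication needs an argument:
  every right vector space is monoartinian. Given subspaces \<open>C i\<close>, Zorn's lemma yields a
  maximal subspace \<open>T\<close> of their product on which all coordinate projections are injective. If none
  of these projections mapped \<open>T\<close> onto \<open>C i\<close>, \<open>T\<close> could be enlarged by a vector whose
  coordinates all avoid the images of \<open>T\<close>; so some \<open>C n\<close> is isomorphic to \<open>T\<close> and embeds in every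
  \<open>C i\<close>. This replaces the choice of bases and the comparison of dimensions.\<close>

section \<open>Right modules, and embeddings between subspaces over a division ring\<close>

context right_module
begin

lemma rsmult_zero [simp]:
  assumes "x \<in> carrier M"
  shows "x \<lhd>\<^bsub>M\<^esub> \<zero>\<^bsub>R\<^esub> = \<zero>\<^bsub>M\<^esub>"
proof -
  have "x \<lhd>\<^bsub>M\<^esub> \<zero>\<^bsub>R\<^esub> \<oplus>\<^bsub>M\<^esub> x \<lhd>\<^bsub>M\<^esub> \<zero>\<^bsub>R\<^esub> = x \<lhd>\<^bsub>M\<^esub> \<zero>\<^bsub>R\<^esub>"
    using rsmult_add_ring[OF assms R.zero_closed R.zero_closed] by simp
  then show ?thesis
    using assms by (metis M.add.l_cancel_one R.zero_closed rsmult_closed)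
qed

lemma rsmult_minus_one:
  assumes "x \<in> carrier M"
  shows "x \<lhd>\<^bsub>M\<^esub> (\<ominus>\<^bsub>R\<^esub> \<one>\<^bsub>R\<^esub>) = \<ominus>\<^bsub>M\<^esub> x"
proof -
  have "x \<lhd>\<^bsub>M\<^esub> (\<ominus>\<^bsub>R\<^esub> \<one>\<^bsub>R\<^esub>) \<oplus>\<^bsub>M\<^esub> x = x \<lhd>\<^bsub>M\<^esub> (\<ominus>\<^bsub>R\<^esub> \<one>\<^bsub>R\<^esub> \<oplus>\<^bsub>R\<^esub> \<one>\<^bsub>R\<^esub>)"
    using assms by (simp add: rsmult_add_ring)
  also have "\<dots> = \<zero>\<^bsub>M\<^esub>"
    using assms by (simp add: R.l_neg)
  finally show ?thesis
    using assms by (simp add: M.minus_equality)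
qed

text \<open>Negatives come from the scalar action, since -x is x acted on by -1.\<close>

lemma right_submodule_iff:
  "right_submodule H R M \<longleftrightarrow>
    H \<subseteq> carrier M \<and> \<zero>\<^bsub>M\<^esub> \<in> H \<and> (\<forall>x \<in> H. \<forall>y \<in> H. x \<oplus>\<^bsub>M\<^esub> y \<in> H)
      \<and> (\<forall>x \<in> H. \<forall>a \<in> carrier R. x \<lhd>\<^bsub>M\<^esub> a \<in> H)" (is "_ \<longleftrightarrow> ?closed")
proof
  assume "right_submodule H R M"
  then interpret H: right_submodule H R M .
  show ?closed
    using H.subset H.m_closed H.one_closed by auto
next
  assume closed: ?closed
  have "\<ominus>\<^bsub>M\<^esub> x \<in> H" if "x \<in> H" for x
    using that closed rsmult_minus_one[of x] R.a_inv_closed[OF R.one_closed] by (metis subsetD)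
  then show "right_submodule H R M"
    using closed
    by (intro right_submodule.intro subgroup.intro right_submodule_axioms.intro)
      (auto simp: a_inv_def)
qed

text \<open>By \<open>right_inv\<close> the scalars form a division ring or the zero ring, so the
  claim amounts to a family of subspaces having a member of least dimension. The set
  \<open>T\<close> built here is a simultaneous graph of isomorphisms between its coordinate
  projections.\<close>

lemma ex_embedded_family:
  fixes C :: "'i \<Rightarrow> 'b set"
  assumes right_inv: "\<And>a. a \<in> carrier R \<Longrightarrow> a \<noteq> \<zero>\<^bsub>R\<^esub> \<Longrightarrow> \<exists>b \<in> carrier R. a \<otimes>\<^bsub>R\<^esub> b = \<one>\<^bsub>R\<^esub>"
    and sub: "\<And>i. right_submodule (C i) R M"
  shows "\<exists>n. \<forall>i. embedded R (M\<lparr>carrier := C n\<rparr>) (M\<lparr>carrier := C i\<rparr>)"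
proof -
  have C_sub: "C i \<subseteq> carrier M" and C_zero: "\<zero>\<^bsub>M\<^esub> \<in> C i"
    and C_add: "\<And>x y. x \<in> C i \<Longrightarrow> y \<in> C i \<Longrightarrow> x \<oplus>\<^bsub>M\<^esub> y \<in> C i"
    and C_smult: "\<And>x a. x \<in> C i \<Longrightarrow> a \<in> carrier R \<Longrightarrow> x \<lhd>\<^bsub>M\<^esub> a \<in> C i" for i
    using sub[of i] unfolding right_submodule_iff by blast+
  \<comment> \<open>\<open>compat T\<close> describes a subspace of the product of all
    \<open>C i\<close> in which distinct vectors differ in every coordinate.\<close>
  define compat :: "('i \<Rightarrow> 'b) set \<Rightarrow> bool" where
    "compat T \<longleftrightarrow> (\<forall>t \<in> T. \<forall>i. t i \<in> C i) \<and> (\<lambda>_. \<zero>\<^bsub>M\<^esub>) \<in> T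
      \<and> (\<forall>s \<in> T. \<forall>t \<in> T. (\<lambda>i. s i \<oplus>\<^bsub>M\<^esub> t i) \<in> T)
      \<and> (\<forall>t \<in> T. \<forall>a \<in> carrier R. (\<lambda>i. t i \<lhd>\<^bsub>M\<^esub> a) \<in> T)
      \<and> (\<forall>s \<in> T. \<forall>t \<in> T. \<forall>i. s i = t i \<longrightarrow> s = t)" for T
  have "compat {\<lambda>_. \<zero>\<^bsub>M\<^esub>}"
  proof -
    have "\<zero>\<^bsub>M\<^esub> \<lhd>\<^bsub>M\<^esub> a = \<zero>\<^bsub>M\<^esub>" if a: "a \<in> carrier R" for a
    proof -
      have "\<zero>\<^bsub>M\<^esub> \<lhd>\<^bsub>M\<^esub> a = \<zero>\<^bsub>M\<^esub> \<lhd>\<^bsub>M\<^esub> a \<oplus>\<^bsub>M\<^esub> \<zero>\<^bsub>M\<^esub> \<lhd>\<^bsub>M\<^esub> a"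
        using rsmult_add_module[OF M.zero_closed M.zero_closed a] by simp
      then show ?thesis
        using a by (metis M.add.l_cancel_one M.zero_closed rsmult_closed)
    qed
    then show ?thesis
      using C_zero by (auto simp: compat_def)
  qed
  moreover have "compat (\<Union>\<T>)" if "\<T> \<noteq> {}" "subset.chain (Collect compat) \<T>" for \<T>
  proof -
    have good: "compat T" if "T \<in> \<T>" for T
      using that \<open>subset.chain _ \<T>\<close> by (auto simp: subset_chain_def)
    \<comment> \<open>Each clause of \<open>compat\<close> involves at most two vectors, so this is
      enough to carry it over to the union.\<close>
    have common: "\<exists>T \<in> \<T>. s \<in> T \<and> t \<in> T" if "s \<in> \<Union>\<T>" "t \<in> \<Union>\<T>" for s t
      using that \<open>subset.chain _ \<T>\<close> unfolding subset_chain_def by blast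
    have "(\<lambda>i. s i \<oplus>\<^bsub>M\<^esub> t i) \<in> \<Union>\<T>" "\<forall>i. s i = t i \<longrightarrow> s = t"
      if "s \<in> \<Union>\<T>" "t \<in> \<Union>\<T>" for s t
      using common[OF that] good unfolding compat_def by blast+
    moreover have "\<forall>i. t i \<in> C i" "\<forall>a \<in> carrier R. (\<lambda>i. t i \<lhd>\<^bsub>M\<^esub> a) \<in> \<Union>\<T>"
      if "t \<in> \<Union>\<T>" for t
      using that good unfolding compat_def by blast+
    moreover have "(\<lambda>_. \<zero>\<^bsub>M\<^esub>) \<in> \<Union>\<T>"
      using \<open>\<T> \<noteq> {}\<close> good unfolding compat_def by blast
    ultimately show ?thesis
      unfolding compat_def by blast
  qed
  ultimately obtain T where T: "compat T" and T_max: "\<And>T'. compat T' \<Longrightarrow> T \<subseteq> T' \<Longrightarrow> T' = T"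
    using subset_Zorn_nonempty[of "Collect compat"] by auto
  have T_C: "\<And>t i. t \<in> T \<Longrightarrow> t i \<in> C i" and T_zero: "(\<lambda>_. \<zero>\<^bsub>M\<^esub>) \<in> T"
    and T_add: "\<And>s t. s \<in> T \<Longrightarrow> t \<in> T \<Longrightarrow> (\<lambda>i. s i \<oplus>\<^bsub>M\<^esub> t i) \<in> T"
    and T_smult: "\<And>t a. t \<in> T \<Longrightarrow> a \<in> carrier R \<Longrightarrow> (\<lambda>i. t i \<lhd>\<^bsub>M\<^esub> a) \<in> T"
    and T_inj: "\<And>s t i. s \<in> T \<Longrightarrow> t \<in> T \<Longrightarrow> s i = t i \<Longrightarrow> s = t"
    using T unfolding compat_def by blast+
  have T_carrier: "t i \<in> carrier M" if "t \<in> T" for t i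
    using T_C[OF that] C_sub by blast
  have "\<exists>n. C n \<subseteq> (\<lambda>t. t n) ` T"
  proof (rule ccontr)
    assume "\<not> ?thesis"
    then have "\<forall>i. \<exists>x. x \<in> C i \<and> x \<notin> (\<lambda>t. t i) ` T"
      by blast
    then obtain v where v_C: "\<And>i. v i \<in> C i" and v_T: "\<And>i. v i \<notin> (\<lambda>t. t i) ` T"
      by metis
    have v_carrier [simp]: "v i \<in> carrier M" for i
      using v_C C_sub by blast
    \<comment> \<open>This is T + vR, the span of \<open>T\<close> and the new vector
      \<open>v\<close>. It will turn out to be \<open>compat\<close> as well.\<close>
    define T' where "T' = {\<lambda>i. t i \<oplus>\<^bsub>M\<^esub> v i \<lhd>\<^bsub>M\<^esub> a | t a. t \<in> T \<and> a \<in> carrier R}"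
    have T'_I: "(\<lambda>i. t i \<oplus>\<^bsub>M\<^esub> v i \<lhd>\<^bsub>M\<^esub> a) \<in> T'" if "t \<in> T" "a \<in> carrier R" for t a
      using that unfolding T'_def by blast
    have "T \<subseteq> T'"
    proof
      fix t assume "t \<in> T"
      then have "(\<lambda>i. t i \<oplus>\<^bsub>M\<^esub> v i \<lhd>\<^bsub>M\<^esub> \<zero>\<^bsub>R\<^esub>) = t"
        by (simp add: T_carrier)
      then show "t \<in> T'"
        using T'_I[OF \<open>t \<in> T\<close> R.zero_closed] by simp
    qed
    moreover have "compat T'"
      unfolding compat_def
    proof (intro conjI ballI allI impI)
      fix t i assume "t \<in> T'"
      then show "t i \<in> C i"
        unfolding T'_def using C_add C_smult T_C v_C by blast
    next
      show "(\<lambda>_. \<zero>\<^bsub>M\<^esub>) \<in> T'"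
        using \<open>T \<subseteq> T'\<close> T_zero by blast
    next
      fix s t assume "s \<in> T'" "t \<in> T'"
      then obtain s' a t' b where
        st: "s' \<in> T" "a \<in> carrier R" "t' \<in> T" "b \<in> carrier R"
          "s = (\<lambda>i. s' i \<oplus>\<^bsub>M\<^esub> v i \<lhd>\<^bsub>M\<^esub> a)" "t = (\<lambda>i. t' i \<oplus>\<^bsub>M\<^esub> v i \<lhd>\<^bsub>M\<^esub> b)"
        unfolding T'_def by blast
      have "(\<lambda>i. s i \<oplus>\<^bsub>M\<^esub> t i) = (\<lambda>i. (s' i \<oplus>\<^bsub>M\<^esub> t' i) \<oplus>\<^bsub>M\<^esub> v i \<lhd>\<^bsub>M\<^esub> (a \<oplus>\<^bsub>R\<^esub> b))"
        using st by (simp add: T_carrier rsmult_add_ring M.a_ac)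
      then show "(\<lambda>i. s i \<oplus>\<^bsub>M\<^esub> t i) \<in> T'"
        using T'_I[OF T_add[OF st(1,3)], of "a \<oplus>\<^bsub>R\<^esub> b"] st by simp
    next
      fix t a assume "t \<in> T'" and a: "a \<in> carrier R"
      then obtain t' b where t: "t' \<in> T" "b \<in> carrier R" "t = (\<lambda>i. t' i \<oplus>\<^bsub>M\<^esub> v i \<lhd>\<^bsub>M\<^esub> b)"
        unfolding T'_def by blast
      have "(\<lambda>i. t i \<lhd>\<^bsub>M\<^esub> a) = (\<lambda>i. t' i \<lhd>\<^bsub>M\<^esub> a \<oplus>\<^bsub>M\<^esub> v i \<lhd>\<^bsub>M\<^esub> (b \<otimes>\<^bsub>R\<^esub> a))"
        using t a by (simp add: T_carrier rsmult_add_module rsmult_assoc)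
      then show "(\<lambda>i. t i \<lhd>\<^bsub>M\<^esub> a) \<in> T'"
        using T'_I[OF T_smult[OF t(1) a], of "b \<otimes>\<^bsub>R\<^esub> a"] t a by simp
    next
      fix s t i assume "s \<in> T'" "t \<in> T'" and eq: "s i = t i"
      then obtain s' a t' b where
        st: "s' \<in> T" "a \<in> carrier R" "t' \<in> T" "b \<in> carrier R"
          "s = (\<lambda>i. s' i \<oplus>\<^bsub>M\<^esub> v i \<lhd>\<^bsub>M\<^esub> a)" "t = (\<lambda>i. t' i \<oplus>\<^bsub>M\<^esub> v i \<lhd>\<^bsub>M\<^esub> b)"
        unfolding T'_def by blast
      have mem: "s' i \<in> carrier M" "t' i \<in> carrier M" "v i \<lhd>\<^bsub>M\<^esub> a \<in> carrier M" "v i \<lhd>\<^bsub>M\<^esub> b \<in> carrier M"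
        using st T_carrier by auto
      have eq': "s' i \<oplus>\<^bsub>M\<^esub> v i \<lhd>\<^bsub>M\<^esub> a = t' i \<oplus>\<^bsub>M\<^esub> v i \<lhd>\<^bsub>M\<^esub> b"
        using eq st by simp
      \<comment> \<open>Otherwise d = a - b has a right inverse c, and solving for
        \<open>v i\<close> gives v i = (t' i - s' i) c, which lies in the i-th projection of
        \<open>T\<close>, against the choice of \<open>v\<close>.\<close>
      have "a = b"
      proof (rule ccontr)
        assume "a \<noteq> b"
        define d where "d = a \<oplus>\<^bsub>R\<^esub> \<ominus>\<^bsub>R\<^esub> b"
        have d: "d \<in> carrier R" "a = d \<oplus>\<^bsub>R\<^esub> b"
          using st by (simp_all add: d_def R.a_assoc R.l_neg)
        with \<open>a \<noteq> b\<close> st obtain c where c: "c \<in> carrier R" "d \<otimes>\<^bsub>R\<^esub> c = \<one>\<^bsub>R\<^esub>"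
          using right_inv[of d] by auto
        have "(s' i \<oplus>\<^bsub>M\<^esub> v i \<lhd>\<^bsub>M\<^esub> d) \<oplus>\<^bsub>M\<^esub> v i \<lhd>\<^bsub>M\<^esub> b = t' i \<oplus>\<^bsub>M\<^esub> v i \<lhd>\<^bsub>M\<^esub> b"
          using eq' mem d st by (simp add: rsmult_add_ring M.a_assoc)
        then have "s' i \<oplus>\<^bsub>M\<^esub> v i \<lhd>\<^bsub>M\<^esub> d = t' i"
          using mem d by simp
        then have "v i \<lhd>\<^bsub>M\<^esub> d = s' i \<lhd>\<^bsub>M\<^esub> (\<ominus>\<^bsub>R\<^esub> \<one>\<^bsub>R\<^esub>) \<oplus>\<^bsub>M\<^esub> t' i"
          using mem d by (simp add: rsmult_minus_one M.r_neg1 flip: \<open>_ = t' i\<close>)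
        then have "v i = (s' i \<lhd>\<^bsub>M\<^esub> (\<ominus>\<^bsub>R\<^esub> \<one>\<^bsub>R\<^esub>) \<oplus>\<^bsub>M\<^esub> t' i) \<lhd>\<^bsub>M\<^esub> c"
          using d c by (metis rsmult_assoc rsmult_one v_carrier)
        \<comment> \<open>The equation for \<open>v i\<close> is known at one index only, but the
          same combination taken in all coordinates is a member of \<open>T\<close>.\<close>
        moreover have "(\<lambda>i. (s' i \<lhd>\<^bsub>M\<^esub> (\<ominus>\<^bsub>R\<^esub> \<one>\<^bsub>R\<^esub>) \<oplus>\<^bsub>M\<^esub> t' i) \<lhd>\<^bsub>M\<^esub> c) \<in> T"
          using T_smult[OF T_add[OF T_smult]] st c by simp
        ultimately show False
          using v_T[of i] by (metis (no_types, lifting) image_iff)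
      qed
      then have "s' i = t' i"
        using eq' mem by simp
      with \<open>a = b\<close> show "s = t"
        using T_inj st by blast
    qed
    ultimately have "T' = T"
      using T_max by blast
    \<comment> \<open>The member of \<open>T'\<close> with zero part in \<open>T\<close> and
      coefficient one is \<open>v\<close> itself.\<close>
    have "(\<lambda>i. \<zero>\<^bsub>M\<^esub> \<oplus>\<^bsub>M\<^esub> v i \<lhd>\<^bsub>M\<^esub> \<one>\<^bsub>R\<^esub>) = v"
      by simp
    then have "v \<in> T"
      using T'_I[OF T_zero R.one_closed] \<open>T' = T\<close> by simp
    then show False
      using v_T by blast
  qed
  then obtain n where n: "C n \<subseteq> (\<lambda>t. t n) ` T"
    by blast
  \<comment> \<open>This inverts the n-th projection of \<open>T\<close>; following it by the i-th
    projection embeds \<open>C n\<close> in \<open>C i\<close>.\<close>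
  define lift where "lift x = inv_into T (\<lambda>t. t n) x" for x
  have lift_T: "lift x \<in> T" and lift_n: "lift x n = x" if "x \<in> C n" for x
    using n that f_inv_into_f[of x "\<lambda>t. t n" T] inv_into_into[of x "\<lambda>t. t n" T]
    by (auto simp: lift_def)
  have "embedded R (M\<lparr>carrier := C n\<rparr>) (M\<lparr>carrier := C i\<rparr>)" for i
  proof -
    \<comment> \<open>Both sides belong to \<open>T\<close> and agree in coordinate
      \<open>n\<close>, so they coincide.\<close>
    have "lift (x \<oplus>\<^bsub>M\<^esub> y) = (\<lambda>i. lift x i \<oplus>\<^bsub>M\<^esub> lift y i)" if "x \<in> C n" "y \<in> C n" for x y
      using that by (intro T_inj[of _ _ n] T_add) (auto simp: lift_T lift_n C_add)
    moreover have "lift (x \<lhd>\<^bsub>M\<^esub> a) = (\<lambda>i. lift x i \<lhd>\<^bsub>M\<^esub> a)" if "x \<in> C n" "a \<in> carrier R" for x a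
      using that by (intro T_inj[of _ _ n] T_smult) (auto simp: lift_T lift_n C_smult)
    ultimately have "(\<lambda>x. lift x i) \<in> rmodule_hom R (M\<lparr>carrier := C n\<rparr>) (M\<lparr>carrier := C i\<rparr>)"
      by (auto simp: rmodule_hom_def T_C lift_T)
    moreover have "inj_on (\<lambda>x. lift x i) (C n)"
      by (rule inj_onI) (metis T_inj lift_T lift_n)
    ultimately show ?thesis
      unfolding embedded_def by auto
  qed
  then show ?thesis
    by blast
qed

end

section \<open>Right ideals of a ring\<close>

lemma regular_rmodule_simps [simp]:
  "carrier (regular_rmodule R) = carrier R" "add (regular_rmodule R) = add R"
  "zero (regular_rmodule R) = zero R" "rsmult (regular_rmodule R) = mult R"
  by (simp_all add: regular_rmodule_def)

context ring
begin

lemma right_ideal_iff: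
  "right_submodule H R (regular_rmodule R) \<longleftrightarrow>
    H \<subseteq> carrier R \<and> \<zero> \<in> H \<and> (\<forall>x \<in> H. \<forall>y \<in> H. x \<oplus> y \<in> H) \<and> (\<forall>x \<in> H. \<forall>a \<in> carrier R. x \<otimes> a \<in> H)"
  using right_module.right_submodule_iff[OF right_module_regular] by simp

text \<open>Left multiplication by \<open>a\<close> is an endomorphism of the regular right module.
  The lemma supplies the right ideals aS and fR used later.\<close>

lemma right_ideal_mult_image:
  assumes "right_submodule H R (regular_rmodule R)" "a \<in> carrier R"
  shows "right_submodule ((\<otimes>) a ` H) R (regular_rmodule R)"
proof -
  have H: "H \<subseteq> carrier R" "\<zero> \<in> H" "\<And>x y. x \<in> H \<Longrightarrow> y \<in> H \<Longrightarrow> x \<oplus> y \<in> H"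
    "\<And>x r. x \<in> H \<Longrightarrow> r \<in> carrier R \<Longrightarrow> x \<otimes> r \<in> H"
    using assms unfolding right_ideal_iff by blast+
  have "a \<otimes> x \<oplus> a \<otimes> y \<in> (\<otimes>) a ` H" if "x \<in> H" "y \<in> H" for x y
    using that H assms by (intro image_eqI[of _ _ "x \<oplus> y"]) (auto simp: r_distr subset_iff)
  moreover have "(a \<otimes> x) \<otimes> r \<in> (\<otimes>) a ` H" if "x \<in> H" "r \<in> carrier R" for x r
    using that H assms by (intro image_eqI[of _ _ "x \<otimes> r"]) (auto simp: m_assoc subset_iff)
  moreover have "\<zero> \<in> (\<otimes>) a ` H"
    using H assms by (intro image_eqI[of _ _ \<zero>]) auto
  ultimately show ?thesis
    unfolding right_ideal_iff using H assms by auto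
qed

lemma right_ideal_carrier: "right_submodule (carrier R) R (regular_rmodule R)"
  unfolding right_ideal_iff by auto

lemma right_ideal_eq_carrier:
  assumes "right_submodule H R (regular_rmodule R)" "\<one> \<in> H"
  shows "H = carrier R"
  using assms unfolding right_ideal_iff by (metis l_one subsetI subset_antisym)

text \<open>Restricting the carrier leaves the operations unchanged, so a right ideal inside
  \<open>S\<close> is a submodule of \<open>S\<close> regarded as a module.\<close>

lemma simple_right_ideal_minimal:
  assumes "S \<in> simple_submodules R (regular_rmodule R)"
    and "right_submodule H R (regular_rmodule R)" "H \<subseteq> S"
  shows "H = {\<zero>} \<or> H = S"
proof -
  have mod: "right_module R ((regular_rmodule R)\<lparr>carrier := S\<rparr>)"
    using assms(1) by (simp add: simple_submodules_def simple_rmodule_def)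
  have "right_submodule H R ((regular_rmodule R)\<lparr>carrier := S\<rparr>)"
    using assms(2,3) unfolding right_module.right_submodule_iff[OF mod] right_ideal_iff by simp
  then show ?thesis
    using assms(1) by (simp add: simple_submodules_def simple_rmodule_def)
qed

text \<open>Zorn's lemma applies because properness, phrased as not containing
  \<open>\<one>\<close>, passes to unions of chains.\<close>

lemma ex_maximal_right_ideal:
  assumes "right_submodule H R (regular_rmodule R)" "H \<noteq> carrier R"
  shows "\<exists>J. maximal_right_ideal J R \<and> H \<subseteq> J"
proof -
  define \<A> where "\<A> = {K. right_submodule K R (regular_rmodule R) \<and> \<one> \<notin> K \<and> H \<subseteq> K}"
  have "H \<in> \<A>"
    using assms right_ideal_eq_carrier by (auto simp: \<A>_def)
  moreover have "\<Union>\<C> \<in> \<A>" if "\<C> \<noteq> {}" "subset.chain \<A> \<C>" for \<C>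
  proof -
    have \<C>: "right_submodule K R (regular_rmodule R)" "\<one> \<notin> K" "H \<subseteq> K" if "K \<in> \<C>" for K
      using that \<open>subset.chain \<A> \<C>\<close> by (auto simp: subset_chain_def \<A>_def)
    have common: "\<exists>K \<in> \<C>. x \<in> K \<and> y \<in> K" if "x \<in> \<Union>\<C>" "y \<in> \<Union>\<C>" for x y
      using that \<open>subset.chain \<A> \<C>\<close> unfolding subset_chain_def by blast
    have "x \<oplus> y \<in> \<Union>\<C>" if "x \<in> \<Union>\<C>" "y \<in> \<Union>\<C>" for x y
      using common[OF that] \<C>(1) unfolding right_ideal_iff by blast
    moreover have "\<Union>\<C> \<subseteq> carrier R" "\<forall>x \<in> \<Union>\<C>. \<forall>a \<in> carrier R. x \<otimes> a \<in> \<Union>\<C>" "\<zero> \<in> \<Union>\<C>"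
      using \<open>\<C> \<noteq> {}\<close> \<C>(1) unfolding right_ideal_iff by blast+
    ultimately have "right_submodule (\<Union>\<C>) R (regular_rmodule R)"
      unfolding right_ideal_iff by blast
    then show ?thesis
      using \<C>(2,3) \<open>\<C> \<noteq> {}\<close> unfolding \<A>_def by blast
  qed
  ultimately obtain J where J: "J \<in> \<A>" and J_max: "\<And>K. K \<in> \<A> \<Longrightarrow> J \<subseteq> K \<Longrightarrow> K = J"
    using subset_Zorn_nonempty[of \<A>] by blast
  have "maximal_right_ideal J R"
    unfolding maximal_right_ideal_def
  proof (intro conjI allI impI)
    show "right_submodule J R (regular_rmodule R)" "J \<noteq> carrier R"
      using J by (auto simp: \<A>_def)
  next
    fix K assume "right_submodule K R (regular_rmodule R) \<and> J \<subseteq> K"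
    then show "K = J \<or> K = carrier R"
      using J J_max[of K] right_ideal_eq_carrier[of K] by (auto simp: \<A>_def)
  qed
  then show ?thesis
    using J by (auto simp: \<A>_def)
qed

section \<open>Semiprime rings and idempotents in minimal right ideals\<close>

lemma idealI_closed:
  assumes "I \<subseteq> carrier R" "\<zero> \<in> I" "\<And>x y. x \<in> I \<Longrightarrow> y \<in> I \<Longrightarrow> x \<oplus> y \<in> I"
    and "\<And>x r. x \<in> I \<Longrightarrow> r \<in> carrier R \<Longrightarrow> x \<otimes> r \<in> I"
    and "\<And>x r. x \<in> I \<Longrightarrow> r \<in> carrier R \<Longrightarrow> r \<otimes> x \<in> I"
  shows "ideal I R"
proof (rule idealI)
  show "ring R"
    by (rule ring_axioms)
  have "\<ominus> x \<in> I" if "x \<in> I" for x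
    using assms(1) assms(4)[OF that, of "\<ominus> \<one>"] that by (auto simp: r_minus subset_iff)
  then show "subgroup I (add_monoid R)"
    using assms(1-3) by (intro subgroup.intro) (auto simp flip: a_inv_def)
qed (use assms in auto)

text \<open>Powers start at the whole ring, so the second power of \<open>I\<close> is (RI)I. As RI
  lies in \<open>I\<close>, this is generated by products of two elements of \<open>I\<close>, which
  vanish.\<close>

lemma semiprime_square_zero:
  assumes "semiprime_ring R" "ideal I R" "\<And>x y. x \<in> I \<Longrightarrow> y \<in> I \<Longrightarrow> x \<otimes> y = \<zero>"
  shows "I = {\<zero>}"
proof -
  interpret I: ideal I R by fact
  have inner: "x \<in> I" if "x \<in> ideal_prod R (carrier R) I" for x
    using that by induction (auto intro: I.I_l_closed)
  have "x = \<zero>" if "x \<in> ideal_prod R (ideal_prod R (carrier R) I) I" for x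
    using that by induction (auto simp: inner assms(3))
  moreover have "\<zero> \<in> ideal_prod R (ideal_prod R (carrier R) I) I"
    using ideal_prod.prod[of \<zero> "ideal_prod R (carrier R) I" \<zero> I R]
      ideal_prod.prod[of \<zero> "carrier R" \<zero> I R] by auto
  ultimately have "ideal_prod R (ideal_prod R (carrier R) I) I = {\<zero>}"
    by blast
  then have "ideal_power R I (Suc (Suc 0)) = {\<zero>}"
    by simp
  then show ?thesis
    using assms unfolding semiprime_ring_def by blast
qed

text \<open>If \<open>S S = 0\<close>, then \<open>S\<close> lies in the square-zero ideal \<open>K \<inter> L\<close>, where \<open>K\<close> is the right annihilator
  of \<open>S\<close> and \<open>L\<close> the left annihilator of \<open>K\<close>.\<close>

lemma semiprime_right_ideal_square_zero:
  assumes "semiprime_ring R" "right_submodule S R (regular_rmodule R)"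
    and zero: "\<And>x y. x \<in> S \<Longrightarrow> y \<in> S \<Longrightarrow> x \<otimes> y = \<zero>"
  shows "S = {\<zero>}"
proof -
  have S: "S \<subseteq> carrier R" "\<zero> \<in> S" "\<And>x a. x \<in> S \<Longrightarrow> a \<in> carrier R \<Longrightarrow> x \<otimes> a \<in> S"
    using assms(2) unfolding right_ideal_iff by blast+
  define K where "K = {x \<in> carrier R. \<forall>s \<in> S. s \<otimes> x = \<zero>}"
  define L where "L = {x \<in> carrier R. \<forall>k \<in> K. x \<otimes> k = \<zero>}"
  \<comment> \<open>Here \<open>S\<close> being a right ideal enters: s(rk) = (sr)k with sr again in
    \<open>S\<close>.\<close>
  have K_l: "r \<otimes> k \<in> K" if "k \<in> K" "r \<in> carrier R" for k r
  proof -
    have "s \<otimes> (r \<otimes> k) = \<zero>" if "s \<in> S" for s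
    proof -
      have "s \<otimes> (r \<otimes> k) = (s \<otimes> r) \<otimes> k"
        using that \<open>k \<in> K\<close> \<open>r \<in> carrier R\<close> S(1) by (auto simp: K_def m_assoc)
      then show ?thesis
        using S(3)[OF that \<open>r \<in> carrier R\<close>] \<open>k \<in> K\<close> by (simp add: K_def)
    qed
    then show ?thesis
      using that by (simp add: K_def)
  qed
  have "ideal K R"
  proof (rule idealI_closed)
    fix x r assume "x \<in> K" "r \<in> carrier R"
    then show "x \<otimes> r \<in> K"
      using S(1) by (auto simp: K_def simp flip: m_assoc)
  qed (use S(1) K_l in \<open>auto simp: K_def r_distr subset_iff\<close>)
  moreover have "ideal L R"
  proof (rule idealI_closed)
    fix x r assume x: "x \<in> L" "r \<in> carrier R"
    show "x \<otimes> r \<in> L"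
      using x K_l by (auto simp: L_def K_def m_assoc)
    show "r \<otimes> x \<in> L"
      using x by (auto simp: L_def K_def m_assoc)
  qed (auto simp: L_def K_def l_distr)
  ultimately have "ideal (K \<inter> L) R"
    by (rule i_intersect)
  then have "K \<inter> L = {\<zero>}"
    by (rule semiprime_square_zero[OF assms(1)]) (auto simp: L_def)
  \<comment> \<open>\<open>S\<close> lies in \<open>K\<close> because SS = 0, and in
    \<open>L\<close> because \<open>K\<close> is annihilated by \<open>S\<close> by its
    definition.\<close>
  moreover have "S \<subseteq> K \<inter> L"
    using S zero by (auto simp: K_def L_def)
  ultimately show ?thesis
    using S by blast
qed

text \<open>As SS is nonzero, aS is nonzero for some a in S, hence aS = S and a = ae with e in S.
  Then ee - e is in \<open>S\<close> and is killed by \<open>a\<close>, and minimality makes the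
  annihilator of \<open>a\<close> in \<open>S\<close> zero.\<close>

lemma minimal_right_ideal_idempotent:
  assumes "semiprime_ring R" and S: "S \<in> simple_submodules R (regular_rmodule R)"
  shows "\<exists>e \<in> S. e \<noteq> \<zero> \<and> e \<otimes> e = e"
proof -
  have S_sub: "right_submodule S R (regular_rmodule R)" and "S \<noteq> {\<zero>}"
    using S by (simp_all add: simple_submodules_def simple_rmodule_def)
  have S_car: "S \<subseteq> carrier R" and S_zero: "\<zero> \<in> S"
    and S_add: "\<And>x y. x \<in> S \<Longrightarrow> y \<in> S \<Longrightarrow> x \<oplus> y \<in> S"
    and S_mult: "\<And>x r. x \<in> S \<Longrightarrow> r \<in> carrier R \<Longrightarrow> x \<otimes> r \<in> S"
    using S_sub unfolding right_ideal_iff by blast+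
  obtain a b where ab: "a \<in> S" "b \<in> S" "a \<otimes> b \<noteq> \<zero>"
    using semiprime_right_ideal_square_zero[OF assms(1) S_sub] \<open>S \<noteq> {\<zero>}\<close> by blast
  have a: "a \<in> carrier R"
    using ab S_car by blast
  have "(\<otimes>) a ` S \<subseteq> S"
    using ab S_mult S_car by blast
  then have "(\<otimes>) a ` S = S"
    using simple_right_ideal_minimal[OF S right_ideal_mult_image[OF S_sub a]] ab by blast
  then obtain e where e: "e \<in> S" "a = a \<otimes> e"
    using ab(1) by blast
  then have e_car: "e \<in> carrier R"
    using S_car by blast
  define A where "A = {x \<in> S. a \<otimes> x = \<zero>}"
  have "right_submodule A R (regular_rmodule R)"
    using S_car S_zero S_add S_mult a unfolding right_ideal_iff A_def
    by (auto simp: r_distr subset_iff simp flip: m_assoc)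
  \<comment> \<open>The alternative A = S is excluded by \<open>b\<close>, which lies in
    \<open>S\<close> and satisfies ab \<noteq> 0.\<close>
  then have "A = {\<zero>}"
    using simple_right_ideal_minimal[OF S, of A] ab unfolding A_def by blast
  moreover have "e \<otimes> e \<oplus> e \<otimes> (\<ominus> \<one>) \<in> A"
  proof -
    have "a \<otimes> (e \<otimes> e \<oplus> e \<otimes> (\<ominus> \<one>)) = (a \<otimes> e) \<otimes> e \<oplus> (a \<otimes> e) \<otimes> (\<ominus> \<one>)"
      using a e_car by (simp add: r_distr m_assoc)
    also have "\<dots> = \<zero>"
      using a by (simp add: r_minus r_neg flip: e(2))
    finally show ?thesis
      using e e_car S_add S_mult by (simp add: A_def)
  qed
  ultimately have "e \<otimes> e \<oplus> \<ominus> e = \<zero>"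
    using e_car by (simp add: r_minus)
  then have "e \<otimes> e = e"
    using e_car by (metis add.inv_solve_right a_inv_def l_zero m_closed zero_closed)
  moreover have "e \<noteq> \<zero>"
    using e a ab S_car by auto
  ultimately show ?thesis
    using e by blast
qed

section \<open>Minimal right ideals of local rings\<close>

text \<open>If both were proper, each would lie in a maximal right ideal; by uniqueness it is the
  same one, and it would contain x + y = 1.\<close>

lemma local_comaximal:
  assumes "local_ring R" "x \<in> H" "y \<in> K" "x \<oplus> y = \<one>"
    and H: "right_submodule H R (regular_rmodule R)" and K: "right_submodule K R (regular_rmodule R)"
  shows "H = carrier R \<or> K = carrier R"
proof (rule ccontr)
  assume "\<not> ?thesis"
  then obtain I J where IJ: "maximal_right_ideal I R" "H \<subseteq> I" "maximal_right_ideal J R" "K \<subseteq> J"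
    using ex_maximal_right_ideal[OF H] ex_maximal_right_ideal[OF K] by blast
  then have "I = J"
    using assms(1) unfolding local_ring_def by blast
  then have "\<one> \<in> I"
    using IJ assms(2-4) unfolding maximal_right_ideal_def right_ideal_iff by (metis subsetD)
  then show False
    using IJ(1) right_ideal_eq_carrier unfolding maximal_right_ideal_def by blast
qed

text \<open>With f = 1 - e, the nonzero idempotent e annihilates fR on the left, so fR is proper.
  But e in S and f in fR add up to 1, so S has to be the whole ring.\<close>

lemma semiprime_local_minimal_right_ideal:
  assumes "semiprime_ring R" "local_ring R" and S: "S \<in> simple_submodules R (regular_rmodule R)"
  shows "S = carrier R"
proof -
  have S_sub: "right_submodule S R (regular_rmodule R)"
    using S by (simp add: simple_submodules_def)
  obtain e where e: "e \<in> S" "e \<noteq> \<zero>" "e \<otimes> e = e"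
    using minimal_right_ideal_idempotent[OF assms(1) S] by blast
  then have e_car: "e \<in> carrier R"
    using S_sub unfolding right_ideal_iff by blast
  define f where "f = \<ominus> e \<oplus> \<one>"
  have f: "f \<in> carrier R" "e \<oplus> f = \<one>"
    using e_car by (simp_all add: f_def r_neg2)
  have ef: "e \<otimes> f = \<zero>"
    using e e_car by (simp add: f_def r_distr r_minus l_neg)
  have "(\<otimes>) f ` carrier R \<noteq> carrier R"
  proof
    assume "(\<otimes>) f ` carrier R = carrier R"
    then obtain x where x: "x \<in> carrier R" "\<one> = f \<otimes> x"
      using one_closed by blast
    have "e = (e \<otimes> f) \<otimes> x"
      using x e_car f by (simp add: m_assoc flip: x(2))
    then show False
      using ef x e by simp
  qed
  moreover have "f \<in> (\<otimes>) f ` carrier R"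
    using f by (intro image_eqI[of _ _ \<one>]) auto
  ultimately show ?thesis
    using local_comaximal[OF assms(2) e(1) _ f(2) S_sub right_ideal_mult_image[OF right_ideal_carrier f(1)]]
    by blast
qed

section \<open>The socle and simple regular modules\<close>

lemma submodule_sum_empty: "submodule_sum (regular_rmodule R) {} = {\<zero>}"
  using group.generate_empty[OF abelian_group.a_group[OF right_module.axioms(2)[OF right_module_regular]]]
  by (simp add: submodule_sum_def)

lemma ex_simple_submodule:
  assumes "socle R (regular_rmodule R) \<noteq> {\<zero>}"
  shows "simple_submodules R (regular_rmodule R) \<noteq> {}"
  using assms submodule_sum_empty by (auto simp: socle_def)

text \<open>The right ideal aR contains a \<noteq> 0, so it is the whole ring and contains
  \<open>\<one>\<close>.\<close>

lemma simple_regular_right_inverse: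
  assumes "carrier R \<in> simple_submodules R (regular_rmodule R)" "a \<in> carrier R" "a \<noteq> \<zero>"
  shows "\<exists>b \<in> carrier R. a \<otimes> b = \<one>"
proof -
  have "a \<in> (\<otimes>) a ` carrier R"
    using assms(2) by (intro image_eqI[of _ _ \<one>]) auto
  then have "(\<otimes>) a ` carrier R = carrier R"
    using simple_right_ideal_minimal[OF assms(1) right_ideal_mult_image[OF right_ideal_carrier assms(2)]]
      assms(2,3) by auto
  then show ?thesis
    using one_closed by (metis imageE)
qed

lemma simple_regular_homogeneous_semisimple:
  assumes "carrier R \<in> simple_submodules R (regular_rmodule R)"
  shows "homogeneous_semisimple R"
proof -
  let ?M = "regular_rmodule R"
  have grp: "group (add_monoid ?M)"
    using right_module_regular abelian_group.a_group right_module.axioms(2) by blast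
  have sum: "submodule_sum ?M {carrier R} = carrier R"
  proof
    show "submodule_sum ?M {carrier R} \<subseteq> carrier R"
      using group.generate_incl[OF grp, of "carrier R"] by (simp add: submodule_sum_def)
    show "carrier R \<subseteq> submodule_sum ?M {carrier R}"
      by (auto simp: submodule_sum_def intro: generate.incl)
  qed
  \<comment> \<open>Removing the only summand leaves the empty family, whose sum is zero.\<close>
  then have "is_direct_sum ?M {carrier R}"
    using submodule_sum_empty by (auto simp: is_direct_sum_def)
  moreover have "rmodule_isomorphic R (?M\<lparr>carrier := carrier R\<rparr>) (?M\<lparr>carrier := carrier R\<rparr>)"
    unfolding rmodule_isomorphic_def by (rule bexI[of _ id]) (auto simp: rmodule_hom_def)
  ultimately show ?thesis
    unfolding homogeneous_semisimple_def
    using assms ring_axioms by (intro conjI exI[of _ "{carrier R}"]) auto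
qed

end

theorem proposition3p31:
  fixes R :: "('a, 'e) ring_scheme"
  assumes "ring R"
    and "semiprime_ring R"
    and "local_ring R"
    and "socle R (regular_rmodule R) \<noteq> {\<zero>\<^bsub>R\<^esub>}"
  shows "(\<forall>M :: ('a, 'm) rmodule. right_module R M \<longrightarrow> monoartinian R M)
    \<longleftrightarrow> homogeneous_semisimple R"
proof -
  interpret ring R by fact
  \<comment> \<open>A nonzero socle provides a minimal right ideal, which must be the whole ring.
    Both sides of the equivalence then follow from this fact.\<close>
  have simple: "carrier R \<in> simple_submodules R (regular_rmodule R)"
    using ex_simple_submodule[OF assms(4)] semiprime_local_minimal_right_ideal[OF assms(2,3)] by auto
  have "monoartinian R M" if "right_module R M" for M :: "('a, 'm) rmodule"
    unfolding monoartinian_def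
    using right_module.ex_embedded_family[OF that simple_regular_right_inverse[OF simple]] by blast
  then show ?thesis
    using simple_regular_homogeneous_semisimple[OF simple] by blast
qed

end
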